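(* Let $\mu$ be a probability measure on $\mathbb{R}^n$. For every compact $C\in\mathcal{C}_n$ and every $p\in[1,\infty]$, the following hold. (i) Let $K=\mathrm{cl}(\mathrm{cone}\,C)$. If $\|\Pi_{K}\|_{L^p(\mu)}<\infty$, then $$\|\Pi_{\lambda C}\|_{L^p(\mu)} \leq \|\Pi_{K}\|_{L^p(\mu)}\quad\text{for each }\lambda>0.$$ Moreover, $\lim_{\lambda\to\infty}\|\Pi_{\lambda C}\|_{L^p(\mu)} = \|\Pi_{K}\|_{L^p(\mu)}$. (ii) For every $\lambda>0$, $\|\Pi_{\lambda C}\|_{L^p(\mu)}\leq \lambda\,\|s_C\|_{L^p(\mu)}$. Moreover, $$\lim_{\lambda\to0^+}\frac{\|\Pi_{\lambda C}\|_{L^p(\mu)}}{\lambda} = \|s_C\|_{L^p(\mu)}.$$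
   Context: $\mathcal{C}_n$ is the class of closed convex sets $C \subset \mathbb{R}^n$ containing the origin. $\Pi_C(x) = \arg\min_{y\in C}\|x-y\|_2$ is the metric projection onto a nonempty closed convex set. $\lambda C=\{\lambda x: x\in C\}$. $\mathrm{cl}$ denotes closure and $\mathrm{cone}\,A=\mathbb{R}_+A=\{\lambda a:\lambda\ge 0, a\in A\}$. The support function is $h_C(x)=\sup_{y\in C}\langle x,y\rangle$. For compact convex $C$, the minimal norm supporting vector in $C$ at $x$ is $s_C(x)=\arg\min_{y\in C}\{\|y\|_2:\langle x,y\rangle=h_C(x)\}$, i.e. the unique element of smallest Euclidean norm in $\{y\in C:\langle x,y\rangle=h_C(x)\}$. For a measurable vector-valued $f$, $\|f\|_{L^p(\mu)} = (\mathbf{E}_{\xi\sim\mu}\|f(\xi)\|_2^p)^{1/p}$ for $1\leq p<\infty$, and $\|f\|_{L^\infty(\mu)}$ is the $\mu$-essential supremum of $\|f(\xi)\|_2$. *)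

theory Defs
  imports "HOL-Probability.Probability"
begin

text \<open>
  The metric projection onto a nonempty closed convex set \<open>C\<close> is the library function
  \<open>closest_point C\<close>. The set \<open>cl (cone C)\<close> is \<open>closure (cone hull C)\<close>, where
  \<open>cone hull C\<close> is the set of all \<open>c *\<^sub>R x\<close> with \<open>c \<ge> 0\<close> and \<open>x \<in> C\<close> (\<open>cone_hull_expl\<close>).
\<close>

definition closed_convex_with_origin :: "'a::real_normed_vector set set" where
  "closed_convex_with_origin = {C. closed C \<and> convex C \<and> 0 \<in> C}"

definition support_function :: "'a::real_inner set \<Rightarrow> 'a \<Rightarrow> ereal" where
  "support_function C x = (SUP y\<in>C. ereal (x \<bullet> y))"

definition min_norm_support :: "'a::real_inner set \<Rightarrow> 'a \<Rightarrow> 'a" where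
  "min_norm_support C x = arg_min_on norm {y \<in> C. ereal (x \<bullet> y) = support_function C x}"

text \<open>
  \<open>L\<^sup>p\<close> norms take values in \<open>[0, \<infinity>]\<close>. The real function \<open>powr\<close> does not extend to \<open>top\<close>,
  so the \<open>p\<close>-th root of an infinite integral is treated separately. The definition is only
  meant for measurable \<open>f\<close> and \<open>p \<ge> 1\<close>.
\<close>

definition ennreal_root :: "real \<Rightarrow> ennreal \<Rightarrow> ennreal" where
  "ennreal_root p a = (if a = \<infinity> then \<infinity> else ennreal (enn2real a powr (1 / p)))"

definition Lp_norm :: "ennreal \<Rightarrow> 'a measure \<Rightarrow> ('a \<Rightarrow> 'b::real_normed_vector) \<Rightarrow> ennreal" where
  "Lp_norm p M f =
    (if p = \<infinity> then esssup M (\<lambda>x. ennreal (norm (f x)))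
     else ennreal_root (enn2real p) (\<integral>\<^sup>+x. ennreal (norm (f x) powr enn2real p) \<partial>M))"

end

theory Submission
  imports Defs
begin

text \<open>
  For fixed \<open>x\<close>, the norm of the projection onto \<open>t C\<close> increases with \<open>t\<close>, while its quotient by
  \<open>t\<close> decreases. The pointwise limits of these monotone families, at infinity and at zero, are
  the norms of the projection onto \<open>K\<close> and of \<open>s\<^sub>C\<close>. Monotonicity bounds the \<open>L\<^sup>p\<close> norms by those of
  the limits, and Fatou's lemma (for \<open>p = \<infinity>\<close>, a countable union of null sets) gives convergence,
  including the case of infinite norms.
\<close>

section \<open>Comparison, lower semicontinuity and homogeneity of \<open>Lp_norm\<close>\<close>

text \<open>Moves the root to the other side, so that finite bounds on a norm become bounds on an
  integral. At \<open>\<infinity>\<close> both sides fail.\<close>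

lemma ennreal_root_le_iff:
  assumes "r > 0" "c \<ge> 0"
  shows "ennreal_root r a \<le> ennreal c \<longleftrightarrow> a \<le> ennreal (c powr r)"
proof (cases a)
  case (real b)
  have "b powr (1 / r) \<le> c \<longleftrightarrow> b \<le> c powr r"
  proof
    assume "b powr (1 / r) \<le> c"
    then have "(b powr (1 / r)) powr r \<le> c powr r"
      using assms by (intro powr_mono2) auto
    then show "b \<le> c powr r" using assms real by (simp add: powr_powr)
  next
    assume "b \<le> c powr r"
    then have "b powr (1 / r) \<le> (c powr r) powr (1 / r)"
      using assms real by (intro powr_mono2) auto
    then show "b powr (1 / r) \<le> c" using assms by (simp add: powr_powr)
  qed
  then show ?thesis using real assms by (simp add: ennreal_root_def ennreal_le_iff)
qed (simp add: ennreal_root_def top_unique)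

lemma enn2real_ge_1: "1 \<le> p \<Longrightarrow> p \<noteq> \<infinity> \<Longrightarrow> 1 \<le> enn2real p"
  by (cases p) auto

lemma Lp_norm_le_iff:
  assumes "1 \<le> p" "p \<noteq> \<infinity>" "c \<ge> 0"
  shows "Lp_norm p M f \<le> ennreal c \<longleftrightarrow>
    (\<integral>\<^sup>+x. ennreal (norm (f x) powr enn2real p) \<partial>M) \<le> ennreal (c powr enn2real p)"
  using assms enn2real_ge_1[of p] by (simp add: Lp_norm_def ennreal_root_le_iff)

text \<open>For measurable functions the essential supremum is the least almost-everywhere bound.
  This is the counterpart of \<open>Lp_norm_le_iff\<close> at
  \<open>p = \<infinity>\<close>.\<close>

lemma Lp_norm_top_le_iff:
  assumes "(\<lambda>x. norm (f x)) \<in> borel_measurable M"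
  shows "Lp_norm \<infinity> M f \<le> ennreal c \<longleftrightarrow> (AE x in M. ennreal (norm (f x)) \<le> ennreal c)"
proof
  assume "Lp_norm \<infinity> M f \<le> ennreal c"
  moreover have "AE x in M. ennreal (norm (f x)) \<le> Lp_norm \<infinity> M f"
    using esssup_AE[where f="\<lambda>x. ennreal (norm (f x))"] by (simp add: Lp_norm_def)
  ultimately show "AE x in M. ennreal (norm (f x)) \<le> ennreal c" by auto
next
  assume "AE x in M. ennreal (norm (f x)) \<le> ennreal c"
  with assms show "Lp_norm \<infinity> M f \<le> ennreal c"
    by (auto simp: Lp_norm_def intro!: esssup_I)
qed

text \<open>An infinite upper bound is trivial; this reduces comparisons to the real bounds handled
  by the two equivalences above.\<close>

lemma ennreal_le_cases:
  assumes "\<And>c. c \<ge> 0 \<Longrightarrow> b = ennreal c \<Longrightarrow> a \<le> b"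
  shows "a \<le> (b :: ennreal)"
  using assms by (cases b) auto

lemma Lp_norm_mono:
  assumes "(\<lambda>x. norm (f x)) \<in> borel_measurable M" "(\<lambda>x. norm (g x)) \<in> borel_measurable M"
    and "1 \<le> p" and le: "\<And>x. norm (f x) \<le> norm (g x)"
  shows "Lp_norm p M f \<le> Lp_norm p M g"
proof (rule ennreal_le_cases)
  fix c :: real assume c: "c \<ge> 0" "Lp_norm p M g = ennreal c"
  show "Lp_norm p M f \<le> Lp_norm p M g"
  proof (cases "p = \<infinity>")
    case True
    with assms show ?thesis
      by (auto simp: Lp_norm_def intro!: esssup_mono ennreal_leI)
  next
    case False
    have "(\<integral>\<^sup>+x. ennreal (norm (f x) powr enn2real p) \<partial>M)
        \<le> (\<integral>\<^sup>+x. ennreal (norm (g x) powr enn2real p) \<partial>M)"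
      by (intro nn_integral_mono ennreal_leI powr_mono2 le) auto
    also have "\<dots> \<le> ennreal (c powr enn2real p)"
      using Lp_norm_le_iff[of p c M g] c False assms(3) by simp
    finally show ?thesis
      using Lp_norm_le_iff[of p c M f] c False assms(3) by simp
  qed
qed

text \<open>Lower semicontinuity of the norm under pointwise convergence: a common bound
  \<open>c\<close> for all the norms survives in the limit.\<close>

lemma Lp_norm_le_SUP:
  assumes meas: "\<And>n::nat. (\<lambda>x. norm (f n x)) \<in> borel_measurable M" and p: "1 \<le> p"
    and lim: "\<And>x. (\<lambda>n. norm (f n x)) \<longlonglongrightarrow> norm (g x)"
  shows "Lp_norm p M g \<le> (SUP n. Lp_norm p M (f n))"
proof (rule ennreal_le_cases)
  fix c :: real assume c: "c \<ge> 0" "(SUP n. Lp_norm p M (f n)) = ennreal c"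
  have le: "Lp_norm p M (f n) \<le> ennreal c" for n
    unfolding c(2)[symmetric] by (rule SUP_upper) simp
  have meas_g[measurable]: "(\<lambda>x. norm (g x)) \<in> borel_measurable M"
    by (rule borel_measurable_LIMSEQ_real[OF lim meas])
  note meas[measurable]
  have "Lp_norm p M g \<le> ennreal c"
  proof (cases "p = \<infinity>")
    case True
    \<comment> \<open>Only countably many indices occur, so one null set serves them all.\<close>
    have "AE x in M. \<forall>n. ennreal (norm (f n x)) \<le> ennreal c"
      unfolding AE_all_countable
      using le True Lp_norm_top_le_iff[OF meas] by auto
    then have "AE x in M. ennreal (norm (g x)) \<le> ennreal c"
    proof eventually_elim
      case (elim x)
      show ?case
        using tendsto_ennrealI[OF lim[of x]] by (rule LIMSEQ_le_const2) (use elim in auto)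
    qed
    then show ?thesis using True Lp_norm_top_le_iff[OF meas_g, of c] by simp
  next
    case False
    define r where "r = enn2real p"
    have r: "r \<ge> 1" using enn2real_ge_1 p False by (simp add: r_def)
    have int_le: "(\<integral>\<^sup>+x. ennreal (norm (f n x) powr r) \<partial>M) \<le> ennreal (c powr r)" for n
      using le[of n] Lp_norm_le_iff[of p c M "f n"] c False p by (simp add: r_def)
    have "(\<lambda>n. ennreal (norm (f n x) powr r)) \<longlonglongrightarrow> ennreal (norm (g x) powr r)" for x
      using r by (intro tendsto_ennrealI tendsto_powr' lim tendsto_const) auto
    then have "liminf (\<lambda>n. ennreal (norm (f n x) powr r)) = ennreal (norm (g x) powr r)" for x
      by (rule lim_imp_Liminf[OF sequentially_bot])
    then have "(\<integral>\<^sup>+x. ennreal (norm (g x) powr r) \<partial>M)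
        = (\<integral>\<^sup>+x. liminf (\<lambda>n. ennreal (norm (f n x) powr r)) \<partial>M)"
      by simp
    also have "\<dots> \<le> liminf (\<lambda>n. \<integral>\<^sup>+x. ennreal (norm (f n x) powr r) \<partial>M)"
      by (rule nn_integral_liminf) measurable
    \<comment> \<open>The uniform bound on the integrals carries over directly to the
      limsup.\<close>
    also have "\<dots> \<le> limsup (\<lambda>n. \<integral>\<^sup>+x. ennreal (norm (f n x) powr r) \<partial>M)"
      by (rule Liminf_le_Limsup) simp
    also have "\<dots> \<le> ennreal (c powr r)"
      by (rule Limsup_bounded) (simp add: int_le)
    finally show ?thesis
      using Lp_norm_le_iff[of p c M g] c False p by (simp add: r_def)
  qed
  then show "Lp_norm p M g \<le> (SUP n. Lp_norm p M (f n))" by (simp add: c)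
qed

text \<open>One half of homogeneity; the other half comes from this one with the factor
  \<open>inverse k\<close>.\<close>

lemma Lp_norm_scaleR_le:
  assumes meas[measurable]: "(\<lambda>x. norm (f x)) \<in> borel_measurable M" and "1 \<le> p" "k > 0"
  shows "Lp_norm p M (\<lambda>x. k *\<^sub>R f x) \<le> ennreal k * Lp_norm p M f"
proof (cases "Lp_norm p M f")
  case top
  then show ?thesis using \<open>k > 0\<close> by (simp add: ennreal_mult_top)
next
  case (real c)
  have "Lp_norm p M (\<lambda>x. k *\<^sub>R f x) \<le> ennreal (k * c)"
  proof (cases "p = \<infinity>")
    case True
    have "AE x in M. ennreal (norm (f x)) \<le> ennreal c"
      using real Lp_norm_top_le_iff[OF meas, of c] True by simp
    then have "AE x in M. ennreal (norm (k *\<^sub>R f x)) \<le> ennreal (k * c)"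
      by eventually_elim (use real \<open>k > 0\<close> in \<open>simp add: ennreal_le_iff\<close>)
    then show ?thesis unfolding True by (subst Lp_norm_top_le_iff) simp_all
  next
    case False
    define r where "r = enn2real p"
    have "(\<integral>\<^sup>+x. ennreal (norm (k *\<^sub>R f x) powr r) \<partial>M)
        = (\<integral>\<^sup>+x. ennreal (k powr r) * ennreal (norm (f x) powr r) \<partial>M)"
      using \<open>k > 0\<close> by (simp add: powr_mult ennreal_mult)
    also have "\<dots> = ennreal (k powr r) * (\<integral>\<^sup>+x. ennreal (norm (f x) powr r) \<partial>M)"
      by (rule nn_integral_cmult) measurable
    also have "\<dots> \<le> ennreal (k powr r) * ennreal (c powr r)"
      using real Lp_norm_le_iff[of p c M f] False assms(2) by (intro mult_left_mono) (simp_all add: r_def)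
    also have "\<dots> = ennreal ((k * c) powr r)"
      using \<open>k > 0\<close> real by (simp add: powr_mult ennreal_mult)
    finally show ?thesis
      using Lp_norm_le_iff[of p "k * c" M "\<lambda>x. k *\<^sub>R f x"] real False assms(2,3) by (simp add: r_def)
  qed
  then show ?thesis using real \<open>k > 0\<close> by (simp add: ennreal_mult)
qed

lemma Lp_norm_scaleR:
  assumes [measurable]: "(\<lambda>x. norm (f x)) \<in> borel_measurable M" and "1 \<le> p" "k > 0"
  shows "Lp_norm p M (\<lambda>x. k *\<^sub>R f x) = ennreal k * Lp_norm p M f"
proof (rule antisym[OF Lp_norm_scaleR_le[OF assms]])
  have "Lp_norm p M f = Lp_norm p M (\<lambda>x. inverse k *\<^sub>R (k *\<^sub>R f x))"
    using \<open>k > 0\<close> by simp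
  also have "\<dots> \<le> ennreal (inverse k) * Lp_norm p M (\<lambda>x. k *\<^sub>R f x)"
    using assms by (intro Lp_norm_scaleR_le) auto
  finally have "ennreal k * Lp_norm p M f
      \<le> ennreal k * (ennreal (inverse k) * Lp_norm p M (\<lambda>x. k *\<^sub>R f x))"
    by (rule mult_left_mono) simp
  also have "\<dots> = Lp_norm p M (\<lambda>x. k *\<^sub>R f x)"
    using \<open>k > 0\<close> by (simp add: mult.assoc[symmetric] ennreal_mult[symmetric])
  finally show "ennreal k * Lp_norm p M f \<le> Lp_norm p M (\<lambda>x. k *\<^sub>R f x)" .
qed

section \<open>Norms of monotone families indexed by a real parameter\<close>

lemma tendsto_at_top_le_of_mono:
  fixes h :: "real \<Rightarrow> 'a::linorder_topology"
  assumes mono: "\<And>s t. 0 < s \<Longrightarrow> s \<le> t \<Longrightarrow> h s \<le> h t" and lim: "(h \<longlongrightarrow> l) at_top" and "t > 0"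
  shows "h t \<le> l"
  by (rule tendsto_lowerbound[OF lim])
    (use mono[OF \<open>t > 0\<close>] in \<open>auto simp: eventually_at_top_linorder\<close>)

text \<open>Monotonicity puts every norm below that of \<open>g\<close>. Semicontinuity along the
  integers gives one index with norm above any \<open>a < Lp_norm p M g\<close>, and monotonicity
  extends this to all later \<open>t\<close>.\<close>

lemma Lp_norm_monotone_convergence:
  fixes F :: "real \<Rightarrow> 'a \<Rightarrow> 'b::real_normed_vector"
  assumes meas: "\<And>t. t > 0 \<Longrightarrow> (\<lambda>x. norm (F t x)) \<in> borel_measurable M" and p: "1 \<le> p"
    and mono: "\<And>s t x. 0 < s \<Longrightarrow> s \<le> t \<Longrightarrow> norm (F s x) \<le> norm (F t x)"
    and lim: "\<And>x. ((\<lambda>t. norm (F t x)) \<longlongrightarrow> norm (g x)) at_top"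
  shows "t > 0 \<Longrightarrow> Lp_norm p M (F t) \<le> Lp_norm p M g"
    and "((\<lambda>t. Lp_norm p M (F t)) \<longlongrightarrow> Lp_norm p M g) at_top"
proof -
  \<comment> \<open>\<open>Suc n\<close> keeps the parameter positive, where measurability and
    monotonicity are available.\<close>
  have lim_seq: "(\<lambda>n. norm (F (real (Suc n)) x)) \<longlonglongrightarrow> norm (g x)" for x
    by (rule filterlim_compose[OF lim])
      (simp add: filterlim_Suc filterlim_compose[OF filterlim_real_sequentially] del: of_nat_Suc)
  have meas_g: "(\<lambda>x. norm (g x)) \<in> borel_measurable M"
    by (rule borel_measurable_LIMSEQ_real[OF lim_seq meas]) simp
  show le: "Lp_norm p M (F t) \<le> Lp_norm p M g" if "t > 0" for t
    by (intro Lp_norm_mono meas meas_g p that tendsto_at_top_le_of_mono[OF mono lim])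
  have sup: "Lp_norm p M g \<le> (SUP n. Lp_norm p M (F (real (Suc n))))"
    by (intro Lp_norm_le_SUP meas p lim_seq) simp
  show "((\<lambda>t. Lp_norm p M (F t)) \<longlongrightarrow> Lp_norm p M g) at_top"
  proof (rule increasing_tendsto)
    show "\<forall>\<^sub>F t in at_top. Lp_norm p M (F t) \<le> Lp_norm p M g"
      using eventually_gt_at_top[of 0] by eventually_elim (rule le)
  next
    fix a assume "a < Lp_norm p M g"
    then obtain n where n: "a < Lp_norm p M (F (real (Suc n)))"
      using less_le_trans[OF _ sup] by (auto simp: less_SUP_iff)
    show "\<forall>\<^sub>F t in at_top. a < Lp_norm p M (F t)"
      using eventually_ge_at_top[of "real (Suc n)"]
    proof eventually_elim
      case (elim t)
      then have "0 < t" using of_nat_0_less_iff[of "Suc n"] by linarith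
      then have "Lp_norm p M (F (real (Suc n))) \<le> Lp_norm p M (F t)"
        using elim by (intro Lp_norm_mono meas p mono) auto
      with n show ?case by simp
    qed
  qed
qed

section \<open>Projections onto scaled copies of a compact convex set, and their limit at
  infinity\<close>

locale convex_body_with_origin =
  fixes C :: "'a::euclidean_space set"
  assumes convex: "convex C" and compact: "compact C" and zero_mem: "0 \<in> C"
begin

lemma scaled_props:
  "convex ((*\<^sub>R) t ` C)" "closed ((*\<^sub>R) t ` C)" "(*\<^sub>R) t ` C \<noteq> {}"
  using convex compact zero_mem
  by (auto intro: convex_scaling compact_imp_closed compact_scaling)

lemma closest_point_scaled_mem: "closest_point ((*\<^sub>R) t ` C) x \<in> (*\<^sub>R) t ` C"
  by (intro closest_point_in_set scaled_props)

text \<open>The variational inequality of the projection, with test points parametrized by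
  \<open>C\<close> itself.\<close>

lemma closest_point_scaled_dot:
  assumes "y \<in> C"
  shows "(x - closest_point ((*\<^sub>R) t ` C) x) \<bullet> (t *\<^sub>R y - closest_point ((*\<^sub>R) t ` C) x) \<le> 0"
  by (intro closest_point_dot scaled_props imageI assms)

lemma closest_point_measurable:
  "(\<lambda>x. norm (closest_point ((*\<^sub>R) t ` C) x)) \<in> borel_measurable borel"
  by (intro borel_measurable_continuous_onI continuous_on_norm continuous_on_closest_point scaled_props)

text \<open>
  With \<open>a\<close> and \<open>b\<close> the projections onto \<open>s C\<close> and \<open>t C\<close>, testing the variational inequality of
  each projection against the rescaled other one and adding up gives
  \<open>(s |b| - t |a|) (|b| - |a|) \<le> 0\<close>, hence both monotonicity statements.
\<close>

lemma norm_closest_point_scaled_mono: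
  assumes "0 < s" "s \<le> t"
  defines "a x \<equiv> closest_point ((*\<^sub>R) s ` C) x" and "b x \<equiv> closest_point ((*\<^sub>R) t ` C) x"
  shows "norm (a x) \<le> norm (b x)" "s * norm (b x) \<le> t * norm (a x)"
proof -
  obtain a' where a': "a' \<in> C" "a x = s *\<^sub>R a'"
    using closest_point_scaled_mem[of s x] by (auto simp: a_def)
  obtain b' where b': "b' \<in> C" "b x = t *\<^sub>R b'"
    using closest_point_scaled_mem[of t x] by (auto simp: b_def)
  define A B where "A = a x" and "B = b x"
  \<comment> \<open>\<open>s *\<^sub>R b'\<close> is \<open>B\<close> shrunk by \<open>s / t\<close>
    into the smaller set; the factor \<open>t\<close> clears this quotient.\<close>
  have 1: "t * ((x - A) \<bullet> (s *\<^sub>R b' - A)) \<le> 0"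
    using closest_point_scaled_dot[OF b'(1), of x s] assms(1,2)
    by (simp add: A_def a_def mult_nonneg_nonpos)
  have 2: "s * ((x - B) \<bullet> (t *\<^sub>R a' - B)) \<le> 0"
    using closest_point_scaled_dot[OF a'(1), of x t] assms(1,2)
    by (simp add: B_def b_def mult_nonneg_nonpos)
  have 3: "t *\<^sub>R (s *\<^sub>R b' - A) = s *\<^sub>R B - t *\<^sub>R A" "s *\<^sub>R (t *\<^sub>R a' - B) = t *\<^sub>R A - s *\<^sub>R B"
    using a' b' by (simp_all add: A_def B_def scaleR_diff_right mult.commute)
  have "(x - A) \<bullet> (s *\<^sub>R B - t *\<^sub>R A) \<le> 0" "(x - B) \<bullet> (t *\<^sub>R A - s *\<^sub>R B) \<le> 0"
    using 1 2 by (simp_all flip: 3 inner_scaleR_right)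
  \<comment> \<open>The two test vectors are opposite, so \<open>x\<close> cancels in the
    sum.\<close>
  then have "s * (B \<bullet> B) + t * (A \<bullet> A) \<le> (s + t) * (A \<bullet> B)"
    by (simp add: inner_diff inner_commute algebra_simps)
  also have "\<dots> \<le> (s + t) * (norm A * norm B)"
    using assms(1,2) by (intro mult_left_mono norm_cauchy_schwarz) auto
  finally have key: "(s * norm B - t * norm A) * (norm B - norm A) \<le> 0"
    by (simp add: dot_square_norm power2_eq_square algebra_simps)
  show le: "norm (a x) \<le> norm (b x)"
  proof (rule ccontr)
    assume "\<not> norm (a x) \<le> norm (b x)"
    then have lt: "norm B < norm A" by (simp add: A_def B_def)
    \<comment> \<open>Both factors in \<open>key\<close> would then be negative and their product
      positive.\<close>
    have "s * norm B < t * norm A"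
      using assms(1,2) lt by (intro mult_le_less_imp_less) auto
    with lt key show False
      using mult_neg_neg[of "s * norm B - t * norm A" "norm B - norm A"] by auto
  qed
  show "s * norm (b x) \<le> t * norm (a x)"
  \<comment> \<open>For equal norms the second factor of \<open>key\<close> vanishes and only
    \<open>s \<le> t\<close> decides.\<close>
  proof (cases "norm A = norm B")
    case True
    then show ?thesis
      using assms(2) mult_right_mono[of s t "norm A"] by (simp add: A_def B_def)
  next
    case False
    with le have "norm B - norm A > 0" by (simp add: A_def B_def)
    with key show ?thesis by (simp add: mult_le_0_iff A_def B_def)
  qed
qed

text \<open>The projections themselves converge: a point of the cone close to the projection
  \<open>k\<close> onto \<open>K\<close> lies in all large multiples of \<open>C\<close>, and the
  two variational inequalities then bound the distance from \<open>a t\<close> to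
  \<open>k\<close>.\<close>

lemma norm_closest_point_scaled_tendsto_at_top:
  defines "K \<equiv> closure (cone hull C)"
  shows "((\<lambda>t. norm (closest_point ((*\<^sub>R) t ` C) x)) \<longlongrightarrow> norm (closest_point K x)) at_top"
proof -
  have K: "convex K" "closed K" "K \<noteq> {}"
    using convex zero_mem convex_cone_hull[of C] cone_hull_contains_0[of C]
    by (auto simp: K_def intro: convex_closure)
  define k where "k = closest_point K x"
  define a where "a t = closest_point ((*\<^sub>R) t ` C) x" for t
  have "k \<in> K" unfolding k_def by (intro closest_point_in_set K)
  have a_in_K: "a t \<in> K" if "t > 0" for t
  proof -
    obtain y where y: "y \<in> C" "a t = t *\<^sub>R y"
      using closest_point_scaled_mem[of t x] by (auto simp: a_def)
    then have "a t \<in> cone hull C"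
      using mem_cone_hull[of y C t] y that by simp
    then show ?thesis unfolding K_def using closure_subset by blast
  qed
  \<comment> \<open>The origin is a competitor in every scaled set.\<close>
  have dist_a: "norm (x - a t) \<le> norm x" for t
    using closest_point_le[OF scaled_props(2), of 0 t x] zero_mem
    by (force simp: a_def dist_norm image_iff)
  have "(a \<longlongrightarrow> k) at_top"
  proof (rule tendstoI)
    fix e :: real assume "e > 0"
    \<comment> \<open>Chosen so that \<open>norm x * d\<close> is less than the square of
      \<open>e\<close>; the added 1 also covers \<open>x = 0\<close>.\<close>
    define d where "d = e\<^sup>2 / (norm x + 1)"
    have "d > 0" unfolding d_def using \<open>e > 0\<close> by (intro divide_pos_pos) (auto intro: add_nonneg_pos)
    then obtain y where y: "y \<in> cone hull C" "dist y k < d"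
      using \<open>k \<in> K\<close> unfolding K_def closure_approachable by blast
    then obtain c z where z: "c \<ge> 0" "z \<in> C" "y = c *\<^sub>R z"
      by (auto simp: cone_hull_expl)
    show "\<forall>\<^sub>F t in at_top. dist (a t) k < e"
      using eventually_gt_at_top[of 0] eventually_ge_at_top[of c]
    proof eventually_elim
      case (elim t)
      \<comment> \<open>For \<open>t \<ge> c\<close> this is a convex combination of
        \<open>z\<close> and the origin, so \<open>y\<close> belongs to the copy of \<open>C\<close>
        scaled by \<open>t\<close>.\<close>
      have "(c / t) *\<^sub>R z \<in> C"
        using convexD_alt[OF convex zero_mem z(2), of "c / t"] elim z(1) by simp
      then have 1: "(x - a t) \<bullet> (y - a t) \<le> 0"
        using closest_point_scaled_dot[of "(c / t) *\<^sub>R z" x t] elim z(3) by (simp add: a_def)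
      have 2: "(x - k) \<bullet> (a t - k) \<le> 0"
        unfolding k_def using elim by (intro closest_point_dot K a_in_K)
      \<comment> \<open>The terms in \<open>y\<close> cancel, leaving the inner product of
        \<open>a t - k\<close> with \<open>(x - k) - (x - a t)\<close>.\<close>
      have "(norm (a t - k))\<^sup>2 = (x - a t) \<bullet> (y - a t) + (x - k) \<bullet> (a t - k) + (x - a t) \<bullet> (k - y)"
        unfolding power2_norm_eq_inner by (simp add: inner_diff inner_commute algebra_simps)
      also have "\<dots> \<le> (x - a t) \<bullet> (k - y)"
        using 1 2 by linarith
      also have "\<dots> \<le> norm (x - a t) * norm (k - y)"
        by (rule norm_cauchy_schwarz)
      also have "\<dots> \<le> norm x * d"
        using dist_a y(2) by (intro mult_mono) (auto simp: dist_norm norm_minus_commute)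
      also have "\<dots> < (norm x + 1) * d"
        using \<open>d > 0\<close> by (simp add: algebra_simps)
      also have "\<dots> = e\<^sup>2"
        unfolding d_def by (simp add: add_nonneg_eq_0_iff)
      finally have "norm (a t - k) < e"
        using \<open>e > 0\<close> by (intro power2_less_imp_less[of _ e]) auto
      then show ?case by (simp add: dist_norm)
    qed
  qed
  then show ?thesis unfolding a_def k_def by (rule tendsto_norm)
qed

section \<open>Minimal norm supporting vectors and the limit at scale zero\<close>

text \<open>By compactness the linear functional attains its maximum over \<open>C\<close>, and the
  norm attains its minimum over the compact set of maximizers, so the \<open>arg_min_on\<close> is a
  genuine minimizer.\<close>

lemma min_norm_support_props:
  shows "min_norm_support C x \<in> C"
    and "y \<in> C \<Longrightarrow> x \<bullet> y \<le> x \<bullet> min_norm_support C x"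
    and "y \<in> C \<Longrightarrow> x \<bullet> min_norm_support C x \<le> x \<bullet> y \<Longrightarrow> norm (min_norm_support C x) \<le> norm y"
proof -
  define S where "S = {y \<in> C. ereal (x \<bullet> y) = support_function C x}"
  have "\<exists>m\<in>C. \<forall>y\<in>C. x \<bullet> y \<le> x \<bullet> m"
  proof (rule continuous_attains_sup[where f = "\<lambda>y. x \<bullet> y", OF compact])
    show "C \<noteq> {}" using zero_mem by auto
    show "continuous_on C (\<lambda>y. x \<bullet> y)" by (intro continuous_intros)
  qed
  then obtain m where m: "m \<in> C" "\<And>y. y \<in> C \<Longrightarrow> x \<bullet> y \<le> x \<bullet> m"
    by auto
  have "support_function C x = ereal (x \<bullet> m)"
    unfolding support_function_def using m by (intro antisym SUP_least SUP_upper) auto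
  then have S_eq: "S = C \<inter> {y. x \<bullet> y = x \<bullet> m}" by (auto simp: S_def)
  have "compact S" unfolding S_eq by (intro compact_Int_closed compact closed_hyperplane)
  moreover have "S \<noteq> {}" using m by (auto simp: S_eq)
  ultimately have "\<exists>y0\<in>S. \<forall>y\<in>S. norm y0 \<le> norm y"
    by (rule continuous_attains_inf[where f = norm]) (intro continuous_intros)
  then obtain y0 where y0: "y0 \<in> S" "\<And>y. y \<in> S \<Longrightarrow> norm y0 \<le> norm y" by auto
  have "min_norm_support C x \<in> S \<and> (\<forall>y\<in>S. norm (min_norm_support C x) \<le> norm y)"
    unfolding min_norm_support_def S_def[symmetric] arg_min_on_def
    by (rule arg_minI[where x = y0 and P = "\<lambda>y. y \<in> S"]) (use y0 in \<open>auto simp: not_less\<close>)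
  then have 1: "min_norm_support C x \<in> C" "x \<bullet> min_norm_support C x = x \<bullet> m"
    and 2: "\<And>y. y \<in> C \<Longrightarrow> x \<bullet> y = x \<bullet> m \<Longrightarrow> norm (min_norm_support C x) \<le> norm y"
    by (auto simp: S_eq)
  show "min_norm_support C x \<in> C" by fact
  show "y \<in> C \<Longrightarrow> x \<bullet> y \<le> x \<bullet> min_norm_support C x" using m 1 by simp
  show "y \<in> C \<Longrightarrow> x \<bullet> min_norm_support C x \<le> x \<bullet> y \<Longrightarrow> norm (min_norm_support C x) \<le> norm y"
    using m 1 2 by (simp add: order_antisym)
qed

text \<open>The reciprocal parameter turns quotients decreasing in the scale into a family
  increasing towards \<open>at_top\<close>, the form that
  \<open>Lp_norm_monotone_convergence\<close> takes.\<close>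

lemma norm_closest_point_scaled_quotient_mono:
  assumes "0 < s" "s \<le> t"
  shows "norm (s *\<^sub>R closest_point ((*\<^sub>R) (inverse s) ` C) x)
    \<le> norm (t *\<^sub>R closest_point ((*\<^sub>R) (inverse t) ` C) x)"
proof -
  have "inverse t * norm (closest_point ((*\<^sub>R) (inverse s) ` C) x)
      \<le> inverse s * norm (closest_point ((*\<^sub>R) (inverse t) ` C) x)"
    using assms by (intro norm_closest_point_scaled_mono) (auto simp: le_imp_inverse_le)
  with assms show ?thesis by (simp add: field_simps)
qed

text \<open>The points \<open>a t\<close> lie in \<open>C\<close>, have norm at most that of
  \<open>s\<close>, and nearly maximize the inner product with \<open>x\<close>. A limit point is
  therefore a maximizer, of norm at least that of \<open>s\<close>.\<close>

lemma norm_closest_point_scaled_quotient_tendsto: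
  "((\<lambda>t. norm (t *\<^sub>R closest_point ((*\<^sub>R) (inverse t) ` C) x)) \<longlongrightarrow> norm (min_norm_support C x)) at_top"
proof -
  define s where "s = min_norm_support C x"
  define a where "a t = t *\<^sub>R closest_point ((*\<^sub>R) (inverse t) ` C) x" for t
  note s_mem = min_norm_support_props(1)[of x, folded s_def]
    and s_max = min_norm_support_props(2)[of _ x, folded s_def]
    and s_min = min_norm_support_props(3)[of _ x, folded s_def]
  have a_mem: "a t \<in> C" if "t > 0" for t
  proof -
    obtain y where "y \<in> C" "closest_point ((*\<^sub>R) (inverse t) ` C) x = inverse t *\<^sub>R y"
      using closest_point_scaled_mem[of "inverse t" x] by auto
    then show ?thesis using that by (simp add: a_def)
  qed
  \<comment> \<open>The variational inequality tested at \<open>s\<close>, cleared of its positive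
    factors \<open>inverse t\<close>.\<close>
  have gap: "t * (x \<bullet> (s - a t)) \<le> a t \<bullet> (s - a t)" if "t > 0" for t
  proof -
    have cl: "closest_point ((*\<^sub>R) (inverse t) ` C) x = inverse t *\<^sub>R a t"
      using that by (simp add: a_def)
    have "(x - inverse t *\<^sub>R a t) \<bullet> (inverse t *\<^sub>R s - inverse t *\<^sub>R a t) \<le> 0"
      using closest_point_scaled_dot[OF s_mem, of x "inverse t"] unfolding cl .
    then have "inverse t * ((x - inverse t *\<^sub>R a t) \<bullet> (s - a t)) \<le> 0"
      by (simp flip: scaleR_diff_right)
    then have "(x - inverse t *\<^sub>R a t) \<bullet> (s - a t) \<le> 0"
      using that by (simp add: mult_le_0_iff)
    then show ?thesis using that by (simp add: inner_diff_left field_simps)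
  qed
  have norm_le: "norm (a t) \<le> norm s" if "t > 0" for t
  proof -
    \<comment> \<open>As \<open>s\<close> is a maximizer, the left side of \<open>gap\<close> is
      nonnegative.\<close>
    have "0 \<le> t * (x \<bullet> (s - a t))"
      using s_max[OF a_mem[OF that]] that by (simp add: inner_diff_right)
    with gap[OF that] have "(norm (a t))\<^sup>2 \<le> a t \<bullet> s"
      by (simp add: inner_diff_right power2_norm_eq_inner)
    also have "\<dots> \<le> norm (a t) * norm s" by (rule norm_cauchy_schwarz)
    finally show ?thesis by (cases "a t = 0") (simp_all add: power2_eq_square)
  qed
  \<comment> \<open>Bounding the right side of \<open>gap\<close> shows that \<open>a t\<close>
    misses the maximum by \<open>O(1/t)\<close>.\<close>
  have dot_ge: "x \<bullet> a t \<ge> x \<bullet> s - (norm s)\<^sup>2 / t" if "t > 0" for t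
  proof -
    have "a t \<bullet> (s - a t) \<le> norm (a t) * norm s"
      using norm_cauchy_schwarz[of "a t" s] inner_ge_zero[of "a t"] unfolding inner_diff_right by linarith
    also have "\<dots> \<le> norm s * norm s"
      by (intro mult_right_mono norm_le that) simp
    finally have "t * (x \<bullet> (s - a t)) \<le> (norm s)\<^sup>2"
      using gap[OF that] by (simp add: power2_eq_square)
    then show ?thesis using that by (simp add: inner_diff_right field_simps)
  qed
  have "((\<lambda>t. norm (a t)) \<longlongrightarrow> norm s) at_top"
  proof (rule increasing_tendsto)
    show "\<forall>\<^sub>F t in at_top. norm (a t) \<le> norm s"
      using eventually_gt_at_top[of 0] by eventually_elim (rule norm_le)
  next
    fix r assume r: "r < norm s"
    \<comment> \<open>One index suffices by monotonicity. If there were none, a subsequential limit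
      would be a maximizer of norm at most \<open>r\<close>, contradicting the minimality of
      \<open>s\<close>.\<close>
    have "\<exists>n. r < norm (a (real (Suc n)))"
    proof (rule ccontr)
      assume "\<nexists>n. r < norm (a (real (Suc n)))"
      then have small: "norm (a (real (Suc n))) \<le> r" for n by (auto simp: not_less)
      have "\<forall>n. a (real (Suc n)) \<in> C" by (intro allI a_mem) simp
      then obtain l \<rho> where l: "l \<in> C" "strict_mono \<rho>" "((\<lambda>n. a (real (Suc n))) \<circ> \<rho>) \<longlonglongrightarrow> l"
        using compact compact_imp_seq_compact seq_compactE by metis
      have "norm l \<le> r"
        by (rule LIMSEQ_le_const2[OF tendsto_norm[OF l(3)]]) (use small in \<open>simp del: of_nat_Suc\<close>)
      moreover have "x \<bullet> s \<le> x \<bullet> l"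
      proof (rule LIMSEQ_le)
        have "(\<lambda>n. x \<bullet> s - (norm s)\<^sup>2 / real (Suc n)) \<longlonglongrightarrow> x \<bullet> s - 0"
          by (intro tendsto_diff tendsto_const LIMSEQ_Suc[OF lim_const_over_n])
        then show "((\<lambda>n. x \<bullet> s - (norm s)\<^sup>2 / real (Suc n)) \<circ> \<rho>) \<longlonglongrightarrow> x \<bullet> s"
          using LIMSEQ_subseq_LIMSEQ[OF _ l(2)] by simp
        show "(\<lambda>n. x \<bullet> ((\<lambda>n. a (real (Suc n))) \<circ> \<rho>) n) \<longlonglongrightarrow> x \<bullet> l"
          by (intro tendsto_inner tendsto_const l(3))
        show "\<exists>N. \<forall>n\<ge>N. ((\<lambda>n. x \<bullet> s - (norm s)\<^sup>2 / real (Suc n)) \<circ> \<rho>) n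
            \<le> x \<bullet> ((\<lambda>n. a (real (Suc n))) \<circ> \<rho>) n"
          unfolding comp_def by (intro exI allI impI dot_ge) simp
      qed
      then have "norm s \<le> norm l" by (rule s_min[OF l(1)])
      ultimately show False using r by simp
    qed
    then obtain n where n: "r < norm (a (real (Suc n)))" ..
    show "\<forall>\<^sub>F t in at_top. r < norm (a t)"
      using eventually_ge_at_top[of "real (Suc n)"]
    proof eventually_elim
      case (elim t)
      then have "norm (a (real (Suc n))) \<le> norm (a t)"
        unfolding a_def by (intro norm_closest_point_scaled_quotient_mono) auto
      with n show ?case by simp
    qed
  qed
  then show ?thesis by (simp add: a_def s_def)
qed

end

section \<open>Passage from the pointwise limits to the norms\<close>

theorem proposition1p4:
  fixes \<mu> :: "(real ^ 'n) measure" and C K :: "(real ^ 'n) set" and p :: ennreal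
  assumes "prob_space \<mu>" and "sets \<mu> = sets borel"
    and "C \<in> closed_convex_with_origin" and "compact C"
    and "1 \<le> p"
    and "K = closure (cone hull C)"
  shows
    "(Lp_norm p \<mu> (closest_point K) < \<infinity> \<longrightarrow>
       (\<forall>t>0. Lp_norm p \<mu> (closest_point ((\<lambda>x. t *\<^sub>R x) ` C)) \<le> Lp_norm p \<mu> (closest_point K)))
     \<and> ((\<lambda>t::real. Lp_norm p \<mu> (closest_point ((\<lambda>x. t *\<^sub>R x) ` C)))
          \<longlongrightarrow> Lp_norm p \<mu> (closest_point K)) at_top
     \<and> (\<forall>t>0. Lp_norm p \<mu> (closest_point ((\<lambda>x. t *\<^sub>R x) ` C))
          \<le> ennreal t * Lp_norm p \<mu> (min_norm_support C))
     \<and> ((\<lambda>t::real. Lp_norm p \<mu> (closest_point ((\<lambda>x. t *\<^sub>R x) ` C)) / ennreal t)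
          \<longlongrightarrow> Lp_norm p \<mu> (min_norm_support C)) (at_right 0)"
proof -
  interpret convex_body_with_origin C
    using assms(3,4) by unfold_locales (auto simp: closed_convex_with_origin_def)
  have meas: "(\<lambda>x. norm (closest_point ((*\<^sub>R) t ` C) x)) \<in> borel_measurable \<mu>" for t
    using closest_point_measurable by (simp add: measurable_cong_sets[OF assms(2) refl])
  then have meas': "(\<lambda>x. norm (t *\<^sub>R closest_point ((*\<^sub>R) (inverse t) ` C) x)) \<in> borel_measurable \<mu>" for t
    by simp
  note cone_conv = Lp_norm_monotone_convergence[where F = "\<lambda>t. closest_point ((*\<^sub>R) t ` C)",
      OF meas assms(5) norm_closest_point_scaled_mono(1) norm_closest_point_scaled_tendsto_at_top,
      folded assms(6)]
  note support_conv = Lp_norm_monotone_convergence[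
      where F = "\<lambda>t x. t *\<^sub>R closest_point ((*\<^sub>R) (inverse t) ` C) x",
      OF meas' assms(5) norm_closest_point_scaled_quotient_mono norm_closest_point_scaled_quotient_tendsto]
  have scale: "Lp_norm p \<mu> (\<lambda>x. t *\<^sub>R closest_point ((*\<^sub>R) (inverse t) ` C) x)
      = ennreal t * Lp_norm p \<mu> (closest_point ((*\<^sub>R) (inverse t) ` C))" if "t > 0" for t
    using that by (intro Lp_norm_scaleR meas assms(5))
  have bound: "Lp_norm p \<mu> (closest_point ((*\<^sub>R) t ` C)) \<le> ennreal t * Lp_norm p \<mu> (min_norm_support C)"
    if "t > 0" for t
  proof -
    \<comment> \<open>Inserting the factor \<open>t * inverse t = 1\<close> exposes the member of
      the reciprocal family at parameter \<open>inverse t\<close>.\<close>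
    have "Lp_norm p \<mu> (closest_point ((*\<^sub>R) t ` C))
        = ennreal t * (ennreal (inverse t) * Lp_norm p \<mu> (closest_point ((*\<^sub>R) t ` C)))"
      using that by (simp add: mult.assoc[symmetric] ennreal_mult[symmetric])
    also have "\<dots> \<le> ennreal t * Lp_norm p \<mu> (min_norm_support C)"
      using support_conv(1)[of "inverse t"] scale[of "inverse t"] that
      by (intro mult_left_mono) auto
    finally show ?thesis .
  qed
  \<comment> \<open>The limit at zero is first taken in the reciprocal variable, where dividing by
    \<open>inverse t\<close> is multiplying by \<open>t\<close>.\<close>
  have "((\<lambda>t. Lp_norm p \<mu> (closest_point ((*\<^sub>R) (inverse t) ` C)) / ennreal (inverse t))
      \<longlongrightarrow> Lp_norm p \<mu> (min_norm_support C)) at_top"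
  proof (rule Lim_transform_eventually[OF support_conv(2)])
    show "\<forall>\<^sub>F t in at_top. Lp_norm p \<mu> (\<lambda>x. t *\<^sub>R closest_point ((*\<^sub>R) (inverse t) ` C) x)
        = Lp_norm p \<mu> (closest_point ((*\<^sub>R) (inverse t) ` C)) / ennreal (inverse t)"
      using eventually_gt_at_top[of 0]
      by eventually_elim
        (simp add: scale divide_ennreal_def inverse_ennreal mult.commute)
  qed
  then have "((\<lambda>t. Lp_norm p \<mu> (closest_point ((*\<^sub>R) t ` C)) / ennreal t)
      \<longlongrightarrow> Lp_norm p \<mu> (min_norm_support C)) (at_right 0)"
    by (simp add: filterlim_at_right_to_top)
  with cone_conv bound show ?thesis by simp
qed

end
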